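(* Let $f\in\mathcal{S}^{+}$ with $f(z)=z+a_2z^2+a_3z^3+\cdots$ and $a_2\neq 0$. Then the function $$g(z)=\frac{(z/f(z))-1}{-a_2}$$ belongs to the class $\mathcal{U}$ in the disc $|z|<|a_2|/2$. The result is best possible: for every $b$ with $0<b\leq 2$ there is an $f\in\mathcal{S}^{+}$ with $|a_2|=b$ such that, for the corresponding function $g$, there is no $R$ with $b/2<R\leq 1$ for which $g$ belongs to $\mathcal{U}$ in the disc $|z|<R$.
   Context: Let $\mathbb{D}=\{z\in\mathbb{C}:|z|<1\}$. $\mathcal{A}$ is the family of all analytic functions $f$ in $\mathbb{D}$ with $f(0)=0=f'(0)-1$, i.e. $f(z)=z+a_2z^2+a_3z^3+\cdots$. $\mathcal{S}\subset\mathcal{A}$ is the class of functions in $\mathcal{A}$ that are univalent (injective) in $\mathbb{D}$. $\mathcal{S}^{+}$ is the class of functions $f\in\mathcal{S}$ with the representation $\frac{z}{f(z)}=1+b_1z+b_2z^2+\cdots$ on $\mathbb{D}$ with $b_n\geq 0$ for all $n=1,2,3,\ldots$ (here $z/f(z)$ has the value $1$ at $z=0$). For $0<R\leq1$, a function $g$ analytic in $\mathbb{D}$ with $g(0)=0=g'(0)-1$ is said to belong to $\mathcal{U}$ in the disc $|z|<R$ if $g(z)\neq0$ for $0<|z|<R$ and $\left|\left(\frac{z}{g(z)}\right)^2g'(z)-1\right|<1$ for all $|z|<R$, where $z/g(z)$ is given the value $1$ at $z=0$. *)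

theory Defs
  imports "HOL-Complex_Analysis.Complex_Analysis"
begin

definition class_A :: "(complex \<Rightarrow> complex) set" where
  "class_A = {f. f holomorphic_on ball 0 1 \<and> f 0 = 0 \<and> deriv f 0 = 1}"

definition class_S :: "(complex \<Rightarrow> complex) set" where
  "class_S = {f \<in> class_A. inj_on f (ball 0 1)}"

(* The n-th Taylor coefficient a_n of f at 0. *)
definition taylor_coeff :: "(complex \<Rightarrow> complex) \<Rightarrow> nat \<Rightarrow> complex" where
  "taylor_coeff f n = fps_nth (fps_expansion f 0) n"

(* The function z / f(z), with its removable singularity at 0 filled in for f in class_A. *)
definition z_over :: "(complex \<Rightarrow> complex) \<Rightarrow> complex \<Rightarrow> complex" where
  "z_over f z = (if z = 0 then 1 else z / f z)"

definition class_S_plus :: "(complex \<Rightarrow> complex) set" where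
  "class_S_plus = {f \<in> class_S. \<exists>b :: nat \<Rightarrow> real. b 0 = 1 \<and> (\<forall>n\<ge>1. b n \<ge> 0) \<and>
     (\<forall>z\<in>ball 0 1. (\<lambda>n. complex_of_real (b n) * z ^ n) sums z_over f z)}"

(* The functions belonging to the class U in the disc |z| < R; the notion only makes sense
   for 0 < R \<le> 1, so this range is part of the definition. *)
definition class_U :: "real \<Rightarrow> (complex \<Rightarrow> complex) set" where
  "class_U R = {g \<in> class_A. 0 < R \<and> R \<le> 1 \<and>
     (\<forall>z. 0 < cmod z \<and> cmod z < R \<longrightarrow> g z \<noteq> 0) \<and>
     (\<forall>z. cmod z < R \<longrightarrow> cmod ((z_over g z)\<^sup>2 * deriv g z - 1) < 1)}"

definition g_of :: "(complex \<Rightarrow> complex) \<Rightarrow> complex \<Rightarrow> complex" where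
  "g_of f z = (z_over f z - 1) / (- taylor_coeff f 2)"

end

theory Submission
  imports Defs
begin

text \<open>
  Write \<open>h(z) = z / f(z) = 1 + b\<^sub>1 z + b\<^sub>2 z\<^sup>2 + \<dots>\<close>, so that \<open>a\<^sub>2 = - b\<^sub>1\<close>. On \<open>[0, 1)\<close> the function
  \<open>h(x) - x h'(x) = 1 - \<Sum> (n - 1) b\<^sub>n x\<^sup>n\<close> has no zero, because it vanishes only where \<open>f'\<close> does;
  hence it stays positive, and \<open>\<Sum> (n - 1) b\<^sub>n \<le> 1\<close>. Positivity of \<open>h\<close> on \<open>(-1, 0]\<close> then gives
  \<open>b\<^sub>1 \<le> 2\<close>. With \<open>g(z) = z (1 + p(z))\<close>, \<open>q = z p'\<close> and \<open>P, Q\<close> the values of \<open>p, q\<close> at \<open>r = |z|\<close>, the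
  inequality \<open>|(z/g)\<^sup>2 g' - 1| < 1\<close> reads \<open>|q - p - p\<^sup>2| < |1 + p|\<^sup>2\<close>. Since \<open>q - p\<close> has nonnegative
  coefficients, it follows from \<open>Q - P + P\<^sup>2 < (1 - P)\<^sup>2\<close>, i.e. from \<open>P + Q < 1\<close>, and indeed
  \<open>P \<le> Q \<le> r / b\<^sub>1 < 1/2\<close>. For \<open>f(z) = z / (1 + b z + z\<^sup>2)\<close> the derivative of \<open>g(z) = z + z\<^sup>2 / b\<close>
  vanishes at \<open>- b/2\<close>, which gives sharpness.
\<close>

section \<open>Power series with nonnegative coefficients on the unit disc\<close>

locale nonneg_powser =
  fixes e :: "nat \<Rightarrow> real"
  assumes nonneg: "0 \<le> e n"
    and summable_e: "0 \<le> r \<Longrightarrow> r < 1 \<Longrightarrow> summable (\<lambda>n. e n * r ^ n)"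
begin

text \<open>In the application \<open>e n\<close> is \<open>b (n + 2)\<close>, so
  \<open>g z / z\<close> is \<open>1 + M z / b 1\<close>. The type stays open because complex values
  are bounded by values at real radii.\<close>

definition M :: "'a::{real_normed_field,banach} \<Rightarrow> 'a" where
  "M z = (\<Sum>n. of_real (e n) * z ^ Suc n)"

definition D :: "'a::{real_normed_field,banach} \<Rightarrow> 'a" where
  "D z = (\<Sum>n. of_real (real (Suc n) * e n) * z ^ n)"

lemma norm_summable_e:
  assumes "norm (z :: 'a::{real_normed_field,banach}) < 1"
  shows "summable (\<lambda>n. norm (of_real (e n) * z ^ n))"
  using summable_e[of "norm z"] assms nonneg by (simp add: norm_mult norm_power)

lemma norm_summable_M:
  assumes "norm (z :: 'a::{real_normed_field,banach}) < 1"
  shows "summable (\<lambda>n. norm (of_real (e n) * z ^ Suc n))"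
  using summable_mult2[OF norm_summable_e[OF assms], of "norm z"]
  by (simp add: norm_mult mult_ac)

text \<open>\<open>M\<close> is put in standard form, with a zero constant term, so that termwise differentiation applies.\<close>
lemma summable_shifted:
  assumes "norm (z :: 'a::{real_normed_field,banach}) < 1"
  shows "summable (\<lambda>n. (case n of 0 \<Rightarrow> 0 | Suc k \<Rightarrow> of_real (e k)) * z ^ n)"
proof -
  let ?m = "case_nat 0 (\<lambda>k. of_real (e k)) :: nat \<Rightarrow> 'a"
  have "summable (\<lambda>n. ?m (Suc n) * z ^ n)"
    using norm_summable_e[OF assms] by (simp add: summable_norm_cancel)
  then show ?thesis
    by (subst (asm) summable_powser_split_head)
qed

lemma diffs_shifted:
  "diffs (case_nat 0 (\<lambda>k. of_real (e k))) =
     (\<lambda>n. of_real (real (Suc n) * e n) :: 'a::{real_normed_field,banach})"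
  by (simp add: diffs_def fun_eq_iff)

lemma norm_summable_D:
  assumes "norm (z :: 'a::{real_normed_field,banach}) < 1"
  shows "summable (\<lambda>n. norm (of_real (real (Suc n) * e n) * z ^ n))"
proof -
  \<comment> \<open>Over the reals at \<open>norm z\<close> all terms are nonnegative, so plain
    convergence there is absolute convergence at \<open>z\<close>.\<close>
  have "summable (\<lambda>n. diffs (case_nat 0 (\<lambda>k. of_real (e k))) n * norm z ^ n)"
    by (rule termdiff_converges[of _ 1]) (use assms summable_shifted[where 'a = real] in auto)
  then show ?thesis
    unfolding diffs_shifted
    by (simp add: norm_mult norm_power nonneg abs_mult del: of_nat_Suc)
qed

lemma M_eq_shifted:
  assumes "norm (z :: 'a::{real_normed_field,banach}) < 1"
  shows "M z = (\<Sum>n. (case n of 0 \<Rightarrow> 0 | Suc k \<Rightarrow> of_real (e k)) * z ^ n)"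
  using suminf_split_head[OF summable_shifted[OF assms]] unfolding M_def by simp

lemma has_field_derivative_M:
  assumes "norm (z :: 'a::{real_normed_field,banach}) < 1"
  shows "(M has_field_derivative D z) (at z)"
proof -
  let ?m = "case_nat 0 (\<lambda>k. of_real (e k)) :: nat \<Rightarrow> 'a"
  have "((\<lambda>z. \<Sum>n. ?m n * z ^ n) has_field_derivative (\<Sum>n. diffs ?m n * z ^ n)) (at z)"
    by (rule termdiffs_strong'[where K = 1]) (use assms summable_shifted in auto)
  then have deriv: "((\<lambda>z. \<Sum>n. ?m n * z ^ n) has_field_derivative D z) (at z)"
    unfolding D_def diffs_shifted .
  have ev: "\<forall>\<^sub>F w in nhds z. M w = (\<Sum>n. ?m n * w ^ n)"
    using eventually_nhds_in_open[of "ball 0 1" z] assms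
    by (auto elim!: eventually_mono simp: M_eq_shifted)
  show ?thesis
    by (rule iffD2[OF DERIV_cong_ev[OF refl ev refl] deriv])
qed

lemma isCont_D:
  assumes "norm (z :: 'a::{real_normed_field,banach}) < 1"
  shows "isCont D z"
proof -
  \<comment> \<open>Continuity at \<open>z\<close> needs convergence at some point of strictly
    larger norm.\<close>
  obtain r where r: "norm z < r" "r < 1"
    using assms dense by blast
  then have r': "norm (of_real r :: 'a) < 1" "norm z < norm (of_real r :: 'a)"
    using le_less_trans[OF norm_ge_zero r(1)] by auto
  have "summable (\<lambda>n. of_real (real (Suc n) * e n) * (of_real r :: 'a) ^ n)"
    by (rule summable_norm_cancel[OF norm_summable_D[OF r'(1)]])
  then have "isCont (\<lambda>z. \<Sum>n. of_real (real (Suc n) * e n) * z ^ n) z"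
    by (rule isCont_powser) (fact r'(2))
  then show ?thesis
    unfolding D_def[abs_def] .
qed

lemma M_of_real:
  assumes "\<bar>x\<bar> < 1"
  shows "(M (of_real x) :: 'a::{real_normed_field,banach}) = of_real (M x)"
  using suminf_of_real[OF summable_norm_cancel[OF norm_summable_M[of x]], where 'a = 'a] assms
  unfolding M_def by simp

lemma D_of_real:
  assumes "\<bar>x\<bar> < 1"
  shows "(D (of_real x) :: 'a::{real_normed_field,banach}) = of_real (D x)"
  using suminf_of_real[OF summable_norm_cancel[OF norm_summable_D[of x]], where 'a = 'a] assms
  unfolding D_def by simp

lemma D_mono:
  assumes "0 \<le> x" "x \<le> y" "y < (1::real)"
  shows "D x \<le> D y"
  unfolding D_def
proof (rule suminf_le)
  show "of_real (real (Suc n) * e n) * x ^ n \<le> of_real (real (Suc n) * e n) * y ^ n" for n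
    using assms nonneg by (auto intro!: mult_left_mono power_mono simp del: of_nat_Suc)
qed (rule summable_norm_cancel[OF norm_summable_D], use assms in simp)+

lemma norm_M_le:
  assumes "norm (z :: 'a::{real_normed_field,banach}) < 1"
  shows "norm (M z) \<le> M (norm z)"
  using summable_norm[OF norm_summable_M[OF assms]] nonneg
  unfolding M_def by (simp add: norm_mult norm_power)

text \<open>The weight \<open>n + 1\<close> of \<open>z * D z\<close> loses 1 to \<open>M z\<close>.
  What remains is nonnegative, so the triangle inequality bounds the difference by its own value at
  \<open>norm z\<close>.\<close>

lemma mult_D_minus_M_sums:
  assumes "norm (z :: 'a::{real_normed_field,banach}) < 1"
  shows "(\<lambda>n. of_real (real n * e n) * z ^ Suc n) sums (z * D z - M z)"
proof -
  have "(\<lambda>n. z * (of_real (real (Suc n) * e n) * z ^ n) - of_real (e n) * z ^ Suc n)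
          sums (z * D z - M z)"
    unfolding D_def M_def
    by (intro sums_diff sums_mult summable_sums summable_norm_cancel[OF norm_summable_D]
        summable_norm_cancel[OF norm_summable_M] assms)
  moreover have "z * (of_real (real (Suc n) * e n) * z ^ n) - of_real (e n) * z ^ Suc n =
      of_real (real n * e n) * z ^ Suc n" for n
    by (simp add: algebra_simps)
  ultimately show ?thesis
    by simp
qed

lemma norm_mult_D_minus_M_le:
  assumes "norm (z :: 'a::{real_normed_field,banach}) < 1"
  shows "norm (z * D z - M z) \<le> norm z * D (norm z) - M (norm z)"
proof -
  have sums: "(\<lambda>n. norm (of_real (real n * e n) * z ^ Suc n)) sums (norm z * D (norm z) - M (norm z))"
    using mult_D_minus_M_sums[of "norm z"] assms nonneg
    by (simp add: norm_mult norm_power)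
  show ?thesis
    using summable_norm[OF sums_summable[OF sums]]
    unfolding sums_unique[OF sums, symmetric] sums_unique[OF mult_D_minus_M_sums[OF assms], symmetric] .
qed

lemma M_le_mult_D:
  assumes "0 \<le> r" "r < (1::real)"
  shows "M r \<le> r * D r"
  using norm_mult_D_minus_M_le[of r] assms
  by (smt (verit, best) norm_ge_zero real_norm_def)

end

section \<open>The quotient z/f(z) of a univalent function\<close>

lemma class_S_nonzero:
  assumes "f \<in> class_S" "z \<in> ball 0 1" "z \<noteq> 0"
  shows "f z \<noteq> 0"
  using assms unfolding class_S_def class_A_def
  by (metis (mono_tags, lifting) centre_in_ball inj_onD mem_Collect_eq zero_less_one)

lemma class_S_z_over_nonzero:
  assumes "f \<in> class_S" "z \<in> ball 0 1"
  shows "z_over f z \<noteq> 0"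
  using class_S_nonzero[OF assms] by (auto simp: z_over_def)

lemma class_S_mult_z_over:
  assumes "f \<in> class_S" "z \<in> ball 0 1"
  shows "f z * z_over f z = z"
  using class_S_nonzero[OF assms] assms(1) by (auto simp: z_over_def class_S_def class_A_def)

text \<open>Compare the coefficients of z^2 in \<open>f z * z_over f z = z\<close>.\<close>

lemma taylor_coeff_2:
  assumes "f \<in> class_S" and hol: "z_over f holomorphic_on ball 0 1"
  shows "taylor_coeff f 2 = - deriv (z_over f) 0"
proof -
  let ?F = "fps_expansion f 0" and ?H = "fps_expansion (z_over f) 0"
  have f: "f holomorphic_on ball 0 1" "f 0 = 0" "deriv f 0 = 1"
    using assms(1) by (auto simp: class_S_def class_A_def)
  have F: "f has_fps_expansion ?F" and H: "z_over f has_fps_expansion ?H"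
    using has_fps_expansion_fps_expansion[of "ball 0 1"] f hol by auto
  have "(\<lambda>z. f z * z_over f z) has_fps_expansion ?F * ?H"
    by (intro has_fps_expansion_mult F H)
  moreover have "\<forall>\<^sub>F z in nhds 0. f z * z_over f z = z"
    using eventually_nhds_in_open[of "ball (0::complex) 1" 0] class_S_mult_z_over[OF assms(1)]
    by (auto elim!: eventually_mono)
  ultimately have "(\<lambda>z. z) has_fps_expansion ?F * ?H"
    by (subst (asm) has_fps_expansion_cong) auto
  then have "?F * ?H = fps_X"
    using has_fps_expansion_fps_X fps_expansion_unique_complex by blast
  then have "fps_nth (?F * ?H) 2 = 0"
    by simp
  moreover have "fps_nth ?F 0 = 0" "fps_nth ?F 1 = 1"
      "fps_nth ?H 0 = 1" "fps_nth ?H 1 = deriv (z_over f) 0"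
    using f by (simp_all add: fps_nth_fps_expansion[OF F] fps_nth_fps_expansion[OF H] z_over_def)
  ultimately show ?thesis
    unfolding taylor_coeff_def
    by (simp add: fps_mult_nth numeral_2_eq_2 add_eq_0_iff)
qed

section \<open>Coefficient bounds in the class S+\<close>

locale S_plus =
  fixes f :: "complex \<Rightarrow> complex" and b :: "nat \<Rightarrow> real"
  assumes f_S: "f \<in> class_S"
    and b0: "b 0 = 1"
    and b_nonneg: "n \<ge> 1 \<Longrightarrow> b n \<ge> 0"
    and b_sums: "z \<in> ball 0 1 \<Longrightarrow> (\<lambda>n. complex_of_real (b n) * z ^ n) sums z_over f z"
begin

text \<open>The linear term is kept out of the tail because \<open>b 1\<close> is the divisor that
  normalizes \<open>g\<close>.\<close>

sublocale nonneg_powser "\<lambda>n. b (Suc (Suc n))"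
proof
  fix r :: real
  assume r: "0 \<le> r" "r < 1"
  have "summable (\<lambda>n. complex_of_real (b n) * complex_of_real r ^ n)"
    using b_sums[of "of_real r"] r by (intro sums_summable) auto
  then have "summable (\<lambda>n. complex_of_real (b n * r ^ n))"
    by simp
  then have "summable (\<lambda>n. b n * r ^ n)"
    by (subst (asm) summable_of_real_iff)
  then show "summable (\<lambda>n. b (Suc (Suc n)) * r ^ n)"
    using summable_powser_ignore_initial_segment[of b 2 r] by simp
qed (use b_nonneg in auto)

lemma z_over_eq:
  fixes z :: complex
  assumes "cmod z < 1"
  shows "z_over f z = 1 + b 1 * z + z * M z"
proof -
  let ?c = "\<lambda>n. complex_of_real (b n) * z ^ n"
  have "(\<lambda>n. ?c (n + 2)) sums (z_over f z - (\<Sum>n<2. ?c n))"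
    using assms by (intro sums_split_initial_segment b_sums) simp
  moreover have "(\<lambda>n. z * (of_real (b (Suc (Suc n))) * z ^ Suc n)) sums (z * M z)"
    unfolding M_def
    by (intro sums_mult summable_sums summable_norm_cancel[OF norm_summable_M] assms)
  then have "(\<lambda>n. ?c (n + 2)) sums (z * M z)"
    by (simp add: mult_ac)
  ultimately have "z_over f z - (\<Sum>n<2. ?c n) = z * M z"
    by (rule sums_unique2)
  then show ?thesis
    by (simp add: b0 numeral_2_eq_2 algebra_simps)
qed

lemma has_field_derivative_z_over:
  fixes z :: complex
  assumes "cmod z < 1"
  shows "(z_over f has_field_derivative (b 1 + (M z + z * D z))) (at z)"
proof -
  have deriv: "((\<lambda>z. 1 + b 1 * z + z * M z) has_field_derivative (b 1 + (M z + z * D z))) (at z)"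
    by (auto intro!: derivative_eq_intros has_field_derivative_M assms)
  have ev: "\<forall>\<^sub>F w in nhds z. 1 + b 1 * w + w * M w = z_over f w"
    using eventually_nhds_in_open[of "ball 0 1" z] assms
    by (auto elim!: eventually_mono simp: z_over_eq)
  show ?thesis
    by (rule iffD1[OF DERIV_cong_ev[OF refl ev refl] deriv])
qed

lemma holomorphic_z_over: "z_over f holomorphic_on ball 0 1"
  by (auto simp: holomorphic_on_open intro!: exI has_field_derivative_z_over)

lemma M_0: "M 0 = (0 :: complex)"
  by (simp add: M_def)

lemma taylor_coeff_f: "taylor_coeff f 2 = - complex_of_real (b 1)"
  using taylor_coeff_2[OF f_S holomorphic_z_over] DERIV_imp_deriv[OF has_field_derivative_z_over[of 0]]
  by (simp add: M_0)

text \<open>Here \<open>1 - z\<^sup>2 * D z\<close> is \<open>h z - z * h' z\<close> for \<open>h = z_over f\<close>.\<close>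
lemma sq_mult_D_neq_1:
  assumes "cmod z < 1"
  shows "z\<^sup>2 * D z \<noteq> 1"
proof
  assume eq: "z\<^sup>2 * D z = 1"
  then have z0: "z \<noteq> 0"
    by auto
  have f: "f holomorphic_on ball 0 1" "inj_on f (ball 0 1)"
    using f_S by (auto simp: class_S_def class_A_def)
  let ?h = "z_over f z" and ?h' = "b 1 + (M z + z * D z)"
  have deriv: "((\<lambda>w. f w * z_over f w) has_field_derivative (deriv f z * ?h + ?h' * f z)) (at z)"
    using assms f
    by (intro DERIV_mult has_field_derivative_z_over holomorphic_derivI[of _ "ball 0 1"]) auto
  have ev: "\<forall>\<^sub>F w in nhds z. f w * z_over f w = w"
    using eventually_nhds_in_open[of "ball 0 1" z] assms class_S_mult_z_over[OF f_S]
    by (auto elim!: eventually_mono)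
  have "((\<lambda>w. w) has_field_derivative (deriv f z * ?h + ?h' * f z)) (at z)"
    by (rule iffD1[OF DERIV_cong_ev[OF refl ev refl] deriv])
  then have 1: "deriv f z * ?h + ?h' * f z = 1"
    using DERIV_ident DERIV_unique by blast
  \<comment> \<open>With this, \<open>z\<close> times the product rule identity reads z f' h + f h =
    z. Since f h = z, the derivative of \<open>f\<close> would vanish, which injectivity
    forbids.\<close>
  have "?h = z * ?h'"
    using z_over_eq[OF assms] eq by (simp add: algebra_simps power2_eq_square)
  then have "z * (deriv f z * ?h + ?h' * f z) = z * deriv f z * ?h + f z * ?h"
    by (simp add: algebra_simps)
  then have "z * deriv f z * ?h = 0"
    using 1 class_S_mult_z_over[OF f_S, of z] assms by simp
  then have "deriv f z = 0"
    using z0 class_S_z_over_nonzero[OF f_S, of z] assms by auto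
  then show False
    using holomorphic_injective_imp_regular[OF f(1) _ f(2)] assms by auto
qed

text \<open>The left side is continuous and 0 at the origin; exceeding or reaching 1 would mean
  taking the excluded value 1 at a real point.\<close>

lemma sq_mult_D_less_1:
  assumes "0 \<le> x" "x < (1::real)"
  shows "x\<^sup>2 * D x < 1"
proof (rule ccontr)
  assume "\<not> ?thesis"
  moreover have "\<forall>t. 0 \<le> t \<and> t \<le> x \<longrightarrow> isCont (\<lambda>t. t\<^sup>2 * D t) t"
    using assms by (auto intro!: continuous_intros isCont_D)
  ultimately obtain t where t: "0 \<le> t" "t \<le> x" "t\<^sup>2 * D t = 1"
    using IVT[of "\<lambda>t. t\<^sup>2 * D t" 0 1 x] assms by auto
  have "(complex_of_real t)\<^sup>2 * D (complex_of_real t) = of_real (t\<^sup>2 * D t)"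
    using t(1,2) assms by (simp add: D_of_real)
  then show False
    using sq_mult_D_neq_1[of "of_real t"] t assms by simp
qed

text \<open>Monotonicity moves the estimate to any \<open>y\<close> between \<open>x\<close> and 1,
  where \<open>D y < 1 / y^2\<close>; then \<open>y\<close> tends to 1.\<close>

lemma D_le_1:
  assumes "0 \<le> x" "x < (1::real)"
  shows "D x \<le> 1"
proof (rule tendsto_le[where F = "at_left 1"])
  show "((\<lambda>y. 1 / y\<^sup>2) \<longlongrightarrow> 1) (at_left (1::real))"
    by (auto intro!: tendsto_eq_intros)
  show "\<forall>\<^sub>F y in at_left 1. D x \<le> 1 / y\<^sup>2"
    using eventually_at_left_real[OF assms(2)]
  proof eventually_elim
    case (elim y)
    have "D x \<le> D y"
      using elim assms by (intro D_mono) auto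
    moreover have "D y < 1 / y\<^sup>2"
      using sq_mult_D_less_1[of y] elim assms by (simp add: field_simps)
    ultimately show ?case
      by simp
  qed
qed auto

text \<open>Positivity of \<open>h (- y)\<close> reads \<open>b 1 * y < 1 - y * M (- y)\<close>, and
  the tail contributes at most \<open>y^2 * D y < 1\<close>. The bound places the disc of radius
  \<open>b 1 / 2\<close> inside the unit disc.\<close>

lemma b1_le_2: "b 1 \<le> 2"
proof (rule tendsto_le[where F = "at_left 1"])
  show "((\<lambda>y. 2 / y) \<longlongrightarrow> 2) (at_left (1::real))"
    by (auto intro!: tendsto_eq_intros)
  show "\<forall>\<^sub>F y in at_left 1. b 1 \<le> 2 / y"
    using eventually_at_left_real[OF zero_less_one]
  proof eventually_elim
    case (elim y)
    then have y: "0 < y" "y < 1"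
      by auto
    define h where "h t = 1 + b 1 * t + t * M t" for t :: real
    have nz: "h t \<noteq> 0" if "\<bar>t\<bar> < 1" for t
    proof -
      have "z_over f (of_real t) = of_real (h t)"
        using that by (simp add: z_over_eq h_def M_of_real)
      then show ?thesis
        using class_S_z_over_nonzero[OF f_S, of "of_real t"] that by auto
    qed
    have "h (- y) > 0"
    proof (rule ccontr)
      assume "\<not> ?thesis"
      moreover have "\<forall>t. - y \<le> t \<and> t \<le> 0 \<longrightarrow> isCont h t"
        unfolding h_def using y
        by (auto intro!: continuous_intros DERIV_isCont[OF has_field_derivative_M])
      ultimately obtain t where "- y \<le> t" "t \<le> 0" "h t = 0"
        using IVT[of h "- y" 0 0] y by (auto simp: h_def)
      then show False
        using nz[of t] y by auto
    qed
    moreover have "- y * M (- y) \<le> y * M y"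
    proof -
      have "- M (- y) \<le> M y"
        using norm_M_le[of "- y"] y by auto
      then show ?thesis
        using mult_left_mono[of "- M (- y)" "M y" y] y by simp
    qed
    moreover have "y * M y \<le> y\<^sup>2 * D y"
      using mult_left_mono[OF M_le_mult_D[of y], of y] y by (simp add: power2_eq_square mult_ac)
    moreover have "y\<^sup>2 * D y < 1"
      using y by (intro sq_mult_D_less_1) auto
    ultimately have "b 1 * y \<le> 2"
      unfolding h_def by linarith
    then show ?case
      using y by (simp add: field_simps)
  qed
qed auto

lemma f_class_S_plus: "f \<in> class_S_plus"
  unfolding class_S_plus_def using f_S b0 b_nonneg b_sums by blast

section \<open>Membership of g in the class U\<close>

lemma g_of_eq:
  assumes "b 1 \<noteq> 0" "cmod z < 1"
  shows "g_of f z = z * (1 + M z / b 1)"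
  using assms z_over_eq[OF assms(2)]
  by (simp add: g_of_def taylor_coeff_f field_simps)

lemma has_field_derivative_g_of:
  assumes "b 1 \<noteq> 0" "cmod z < 1"
  shows "(g_of f has_field_derivative (1 + M z / b 1 + z * D z / b 1)) (at z)"
proof -
  have "((\<lambda>w. (z_over f w - 1) / (- taylor_coeff f 2)) has_field_derivative
      (b 1 + (M z + z * D z)) / b 1) (at z)"
    unfolding taylor_coeff_f using assms
    by (auto intro!: derivative_eq_intros has_field_derivative_z_over)
  then show ?thesis
    using assms unfolding g_of_def[abs_def] by (simp add: add_divide_distrib add.assoc)
qed

lemma g_of_class_A:
  assumes "b 1 \<noteq> 0"
  shows "g_of f \<in> class_A"
proof -
  have "g_of f holomorphic_on ball 0 1"
    by (auto simp: holomorphic_on_open intro!: exI has_field_derivative_g_of[OF assms])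
  moreover have "deriv (g_of f) 0 = 1"
    using DERIV_imp_deriv[OF has_field_derivative_g_of[OF assms, of 0]] by (simp add: M_0)
  ultimately show ?thesis
    by (simp add: class_A_def g_of_def z_over_def)
qed

lemma g_of_class_U:
  assumes "b 1 \<noteq> 0"
  shows "g_of f \<in> class_U (b 1 / 2)"
proof -
  have b1: "b 1 > 0"
    using b_nonneg[of 1] assms by simp
  have bounds: "g_of f z \<noteq> 0" "cmod ((z_over (g_of f) z)\<^sup>2 * deriv (g_of f) z - 1) < 1"
    if z: "z \<noteq> 0" "cmod z < b 1 / 2" for z
  proof -
    define r where "r = cmod z"
    have r: "0 \<le> r" "r < 1" "r < b 1 / 2"
      using z b1_le_2 by (auto simp: r_def)
    define p q P Q where "p = M z / b 1" and "q = z * D z / b 1"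
      and "P = M r / b 1" and "Q = r * D r / b 1"
    have "cmod p \<le> P"
      using norm_M_le[of z] r b1
      by (simp add: p_def P_def r_def norm_divide divide_right_mono)
    have "q - p = (z * D z - M z) / b 1" "Q - P = (r * D r - M r) / b 1"
      by (simp_all add: p_def q_def P_def Q_def diff_divide_distrib)
    then have "cmod (q - p) \<le> Q - P"
      using norm_mult_D_minus_M_le[of z] r b1
      by (simp add: r_def norm_divide divide_right_mono)
    have "P \<le> Q"
      using \<open>cmod (q - p) \<le> Q - P\<close> norm_ge_zero[of "q - p"] by linarith
    have "r * D r \<le> r"
      using mult_left_mono[OF D_le_1[of r], of r] r by simp
    \<comment> \<open>The radius \<open>b 1 / 2\<close> is exactly what turns \<open>r / b 1\<close>
      into a quantity below 1/2.\<close>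
    then have "Q < 1 / 2"
      using r b1 by (simp add: Q_def field_simps)
    have G: "1 - P \<le> cmod (1 + p)"
      using \<open>cmod p \<le> P\<close> norm_triangle_ineq4[of "1 + p" p] by simp
    then have nz: "1 + p \<noteq> 0"
      using \<open>P \<le> Q\<close> \<open>Q < 1 / 2\<close> by auto
    have g: "g_of f z = z * (1 + p)"
      using g_of_eq[of z] b1 r by (simp add: p_def r_def)
    show "g_of f z \<noteq> 0"
      using g nz z by simp
    have "deriv (g_of f) z = 1 + p + q"
      using DERIV_imp_deriv[OF has_field_derivative_g_of[of z]] b1 r by (simp add: p_def q_def r_def)
    moreover have "z_over (g_of f) z = 1 / (1 + p)"
      using z g by (simp add: z_over_def)
    ultimately have "(z_over (g_of f) z)\<^sup>2 * deriv (g_of f) z - 1 =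
        ((1 + p + q) - (1 + p)\<^sup>2) / (1 + p)\<^sup>2"
      using nz by (simp add: power_divide diff_divide_distrib)
    moreover have "(1 + p + q) - (1 + p)\<^sup>2 = (q - p) - p\<^sup>2"
      by (simp add: power2_eq_square algebra_simps)
    moreover have "cmod ((q - p) - p\<^sup>2) < (cmod (1 + p))\<^sup>2"
    proof -
      have "cmod ((q - p) - p\<^sup>2) \<le> cmod (q - p) + (cmod p)\<^sup>2"
        using norm_triangle_ineq4[of "q - p" "p\<^sup>2"] by (simp add: norm_power)
      also have "\<dots> \<le> (Q - P) + P\<^sup>2"
        using \<open>cmod (q - p) \<le> Q - P\<close> \<open>cmod p \<le> P\<close> by (intro add_mono power_mono) auto
      \<comment> \<open>The difference of the two sides is \<open>1 - P - Q\<close>.\<close>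
      also have "\<dots> < (1 - P)\<^sup>2"
        using \<open>P \<le> Q\<close> \<open>Q < 1 / 2\<close> by (simp add: power2_eq_square algebra_simps)
      also have "\<dots> \<le> (cmod (1 + p))\<^sup>2"
        using G \<open>P \<le> Q\<close> \<open>Q < 1 / 2\<close> by (intro power_mono) auto
      finally show ?thesis .
    qed
    ultimately show "cmod ((z_over (g_of f) z)\<^sup>2 * deriv (g_of f) z - 1) < 1"
      using nz by (simp add: norm_divide norm_power divide_less_eq)
  qed
  \<comment> \<open>The origin was excluded from \<open>bounds\<close>; there the expression inside
    the modulus is 1 - 1 = 0.\<close>
  have "deriv (g_of f) 0 = 1"
    using g_of_class_A[OF assms] by (simp add: class_A_def)
  then have "cmod ((z_over (g_of f) z)\<^sup>2 * deriv (g_of f) z - 1) < 1"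
    if "cmod z < b 1 / 2" for z
    using bounds(2)[of z] that by (cases "z = 0") (auto simp: z_over_def)
  then show ?thesis
    using g_of_class_A[OF assms] bounds(1) b1 b1_le_2 by (auto simp: class_U_def)
qed

end

section \<open>Sharpness of the radius\<close>

lemma class_U_radius_le:
  assumes "g \<in> class_U R" "deriv g z = 0"
  shows "R \<le> cmod z"
proof (rule ccontr)
  assume "\<not> ?thesis"
  then have "cmod ((z_over g z)\<^sup>2 * deriv g z - 1) < 1"
    using assms(1) by (auto simp: class_U_def)
  \<comment> \<open>At a critical point the expression is -1, whose modulus is not below 1.\<close>
  then show False
    using assms(2) by simp
qed

text \<open>A real root x would give (1 - |x|)^2 <= 0. For a nonreal root the imaginary part forces
  \<open>b = - 2 * Re z\<close>, and the real part then says |z| = 1.\<close>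

lemma quadratic_nonzero:
  assumes "\<bar>b\<bar> \<le> 2" "cmod z < 1"
  shows "1 + complex_of_real b * z + z\<^sup>2 \<noteq> 0"
proof
  assume "1 + complex_of_real b * z + z\<^sup>2 = 0"
  then have re: "1 + b * Re z + (Re z)\<^sup>2 - (Im z)\<^sup>2 = 0" and im: "Im z * (b + 2 * Re z) = 0"
    by (auto simp: complex_eq_iff power2_eq_square algebra_simps)
  have z: "(Re z)\<^sup>2 + (Im z)\<^sup>2 < 1"
    using assms(2) by (simp add: cmod_def)
  from im consider "Im z = 0" | "b = - 2 * Re z"
    by (auto simp: add_eq_0_iff)
  then show False
  proof cases
    case 1
    have "\<bar>b * Re z\<bar> \<le> 2 * \<bar>Re z\<bar>"
      using assms(1) by (simp add: abs_mult mult_right_mono)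
    moreover have "\<bar>Re z\<bar> < 1"
      using assms(2) abs_Re_le_cmod[of z] by simp
    then have "0 < (1 - \<bar>Re z\<bar>)\<^sup>2"
      by simp
    ultimately show False
      using re 1 by (simp add: power2_diff)
  next
    case 2
    then show False
      using re z by (simp add: power2_eq_square)
  qed
qed

text \<open>The tail of z/f(z) is z^2 alone, which attains equality in \<open>D_le_1\<close>. For
  \<open>b = 2\<close> this is z/(1+z)^2, a rotation of the Koebe function.\<close>

definition extremal :: "real \<Rightarrow> complex \<Rightarrow> complex" where
  "extremal b z = z / (1 + of_real b * z + z\<^sup>2)"

text \<open>Valid on the whole plane: at a zero of the denominator both divisions default to 0,
  which is also the value of the quadratic.\<close>

lemma z_over_extremal: "z_over (extremal b) z = 1 + of_real b * z + z\<^sup>2"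
  by (auto simp: z_over_def extremal_def)

lemma extremal_class_S:
  assumes "\<bar>b\<bar> \<le> 2"
  shows "extremal b \<in> class_S"
proof -
  note nz = quadratic_nonzero[OF assms]
  have deriv: "(extremal b has_field_derivative (1 - z\<^sup>2) / (1 + of_real b * z + z\<^sup>2)\<^sup>2) (at z)"
    if "cmod z < 1" for z
    unfolding extremal_def[abs_def] using nz[OF that]
    by (auto intro!: derivative_eq_intros simp: power2_eq_square algebra_simps)
  have "extremal b holomorphic_on ball 0 1"
    by (auto simp: holomorphic_on_open intro!: exI deriv)
  moreover have "deriv (extremal b) 0 = 1"
    using DERIV_imp_deriv[OF deriv[of 0]] by simp
  moreover have "inj_on (extremal b) (ball 0 1)"
  proof (rule inj_onI)
    fix z w :: complex
    assume zw: "z \<in> ball 0 1" "w \<in> ball 0 1" and "extremal b z = extremal b w"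
    then have "z * (1 + of_real b * w + w\<^sup>2) = w * (1 + of_real b * z + z\<^sup>2)"
      using nz by (simp add: extremal_def frac_eq_eq)
    \<comment> \<open>The terms with \<open>b\<close> cancel after cross-multiplication.\<close>
    then have "(z - w) * (1 - z * w) = 0"
      by algebra
    moreover have "z * w \<noteq> 1"
      using norm_mult_less[of z 1 w 1] zw by auto
    ultimately show "z = w"
      by simp
  qed
  ultimately show ?thesis
    by (simp add: class_S_def class_A_def extremal_def)
qed

lemma S_plus_extremal:
  assumes "0 \<le> b" "b \<le> 2"
  shows "S_plus (extremal b) (\<lambda>n. if n = 0 then 1 else if n = 1 then b else if n = 2 then 1 else 0)"
    (is "S_plus _ ?b")
proof
  fix z :: complex
  have "(\<lambda>n. complex_of_real (?b n) * z ^ n) sums (\<Sum>n\<in>{0,1,2}. complex_of_real (?b n) * z ^ n)"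
    by (rule sums_finite) auto
  then show "(\<lambda>n. complex_of_real (?b n) * z ^ n) sums z_over (extremal b) z"
    by (simp add: z_over_extremal add.assoc)
qed (use assms extremal_class_S[of b] in auto)

lemma extremal_sharp:
  assumes "0 < b" "b \<le> 2" "g_of (extremal b) \<in> class_U R"
  shows "R \<le> b / 2"
proof -
  interpret S_plus "extremal b" "\<lambda>n. if n = 0 then 1 else if n = 1 then b else if n = 2 then 1 else 0"
    using assms by (intro S_plus_extremal) auto
  \<comment> \<open>Equality on the whole plane matters for \<open>b = 2\<close>, where the critical
    point \<open>- b / 2\<close> lies on the unit circle.\<close>
  have "g_of (extremal b) = (\<lambda>z. z + z\<^sup>2 / of_real b)"
    using assms(1) taylor_coeff_f by (auto simp: g_of_def z_over_extremal field_simps)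
  moreover have "((\<lambda>z. z + z\<^sup>2 / of_real b) has_field_derivative 0) (at (- complex_of_real b / 2))"
    using assms(1) by (auto intro!: derivative_eq_intros)
  ultimately have "deriv (g_of (extremal b)) (- complex_of_real b / 2) = 0"
    using DERIV_imp_deriv by metis
  then show ?thesis
    using class_U_radius_le[OF assms(3), of "- complex_of_real b / 2"] assms(1)
    by (simp add: norm_divide)
qed

theorem theorem2:
  shows "(\<forall>f \<in> class_S_plus. taylor_coeff f 2 \<noteq> 0 \<longrightarrow>
            g_of f \<in> class_U (cmod (taylor_coeff f 2) / 2)) \<and>
         (\<forall>b::real. 0 < b \<and> b \<le> 2 \<longrightarrow>
            (\<exists>f \<in> class_S_plus. cmod (taylor_coeff f 2) = b \<and>
               \<not> (\<exists>R. b / 2 < R \<and> R \<le> 1 \<and> g_of f \<in> class_U R)))"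
proof (intro conjI ballI allI impI)
  fix f
  assume "f \<in> class_S_plus" and a2: "taylor_coeff f 2 \<noteq> 0"
  then obtain b where "S_plus f b"
    unfolding class_S_plus_def S_plus_def by blast
  then interpret S_plus f b .
  show "g_of f \<in> class_U (cmod (taylor_coeff f 2) / 2)"
    using g_of_class_U a2 b_nonneg[of 1] by (simp add: taylor_coeff_f)
next
  fix b :: real
  assume b: "0 < b \<and> b \<le> 2"
  then interpret S_plus "extremal b" "\<lambda>n. if n = 0 then 1 else if n = 1 then b else if n = 2 then 1 else 0"
    by (intro S_plus_extremal) auto
  have "extremal b \<in> class_S_plus"
    by (rule f_class_S_plus)
  moreover have "cmod (taylor_coeff (extremal b) 2) = b"
    using b by (simp add: taylor_coeff_f)
  ultimately show "\<exists>f \<in> class_S_plus. cmod (taylor_coeff f 2) = b \<and>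
      \<not> (\<exists>R. b / 2 < R \<and> R \<le> 1 \<and> g_of f \<in> class_U R)"
    using extremal_sharp[of b] b by fastforce
qed

end
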